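(* Let $\hat\theta_{\setminus j}=(\hat\theta^{\mathrm{asym}}_{jk})_{k\ne j}$, $j=1,\dots,p$, be the asymmetric nodewise estimates of the oracle two-step procedure, and let $\hat S_j=\{k\ne j:\hat\theta^{\mathrm{asym}}_{jk}\ne0\}$. Suppose that exact neighborhood recovery with sign consistency holds uniformly over all nodes, i.e. $$\mathbb P\left(\text{for all }j=1,\dots,p:\ \hat S_j=S_j\ \text{and}\ \operatorname{sign}(\hat\theta^{\mathrm{asym}}_{jk})=\operatorname{sign}(\theta^\ast_{jk})\ \text{for all }k\in S_j\right)\to1.$$ Let $\hat E$ be the edge set obtained by the AND rule applied to the asymmetric nodewise estimates. Then $\mathbb P(\hat E=E)\to1$.
   Context: $\theta^\ast\in\mathbb R^{p\times p}$ is the symmetric, zero-diagonal target interaction matrix of an Ising model on nodes $V=\{1,\dots,p\}$. $E=\{\{j,k\}:1\le j<k\le p,\ \theta^\ast_{jk}\ne0\}$ is the target edge set and $S_j=\{k\ne j:\theta^\ast_{jk}\ne0\}$. Limits are along a sequence of problems in which the target sample size $n_0$ and the dimension $p$ grow. Oracle two-step procedure. There is a target data set $X^{(0)}\in\{-1,1\}^{n_0\times p}$ and informative source data sets $X^{(s)}\in\{-1,1\}^{n_s\times p}$, $s\in\mathcal A$; $N=n_0+\sum_{s\in\mathcal A}n_s$, $f(t)=\log(1+e^{-t})$. For each node $j$ put $\ell^{(r)}_j(u)=\frac1{n_r}\sum_{i=1}^{n_r}f(2\sum_{k\ne j}u_kx^{(r)}_{ij}x^{(r)}_{ik})$. Step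 1: $\hat w^A_{\setminus j}=\arg\min_u\{\sum_{r\in\{0\}\cup\mathcal A}\frac{n_r}{N}\ell^{(r)}_j(u)+\lambda_w\|u\|_1\}$. Step 2: $\hat\delta^A_{\setminus j}$ is the local solution returned by an optimization routine for $\delta\mapsto\ell^{(0)}_j(\hat w^A_{\setminus j}+\delta)+\lambda_\delta\|\delta\|_1+\sum_{k\ne j}P_\lambda(\hat w^A_{jk}+\delta_{jk})$, where $P_\lambda$ is the SCAD penalty with parameter $a>2$: $P_\lambda(t)=\lambda|t|$ if $|t|\le\lambda$; $\frac{-t^2+2a\lambda|t|-\lambda^2}{2(a-1)}$ if $\lambda<|t|\le a\lambda$; $\frac{(a+1)\lambda^2}{2}$ if $|t|>a\lambda$. The asymmetric estimate is $\hat\theta^{\mathrm{asym}}_{jk}=\hat w^A_{jk}+\hat\delta^A_{jk}$. AND rule: $\{j,k\}\in\hat E$ if and only if $\hat\theta^{\mathrm{asym}}_{jk}\ne0$ and $\hat\theta^{\mathrm{asym}}_{kj}\ne0$ (the symmetrized value is then the average of the two entries, and is $0$ for other pairs). *)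

theory Defs
  imports "HOL-Probability.Probability"
begin

definition spin_configs :: "nat \<Rightarrow> (nat \<Rightarrow> real) set" where
  "spin_configs p = {1..p} \<rightarrow>\<^sub>E {-1, 1}"

definition ising_weight :: "nat \<Rightarrow> (nat \<Rightarrow> nat \<Rightarrow> real) \<Rightarrow> (nat \<Rightarrow> real) \<Rightarrow> real" where
  "ising_weight p \<theta> x = exp (\<Sum>j\<in>{1..p}. \<Sum>k\<in>{j<..p}. \<theta> j k * x j * x k)"

text \<open>With one term per unordered pair in the exponent, the conditional probability of \<open>x j\<close> given
  the other spins is \<open>1 / (1 + exp (- 2 * (\<Sum>k\<noteq>j. \<theta> j k * x j * x k)))\<close>, so that \<open>node_loss\<close>
  below is the averaged negative conditional log-likelihood.\<close>

definition ising_prob :: "nat \<Rightarrow> (nat \<Rightarrow> nat \<Rightarrow> real) \<Rightarrow> (nat \<Rightarrow> real) \<Rightarrow> real" where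
  "ising_prob p \<theta> x = ising_weight p \<theta> x / (\<Sum>y\<in>spin_configs p. ising_weight p \<theta> y)"

lemma finite_spin_configs: "finite (spin_configs p)"
  unfolding spin_configs_def by (intro finite_PiE) auto

lemma sum_ising_prob: "(\<Sum>x\<in>spin_configs p. ising_prob p \<theta> x) = 1"
proof -
  have "spin_configs p \<noteq> {}"
    by (auto simp: spin_configs_def PiE_eq_empty_iff)
  then have "(\<Sum>y\<in>spin_configs p. ising_weight p \<theta> y) > 0"
    by (intro sum_pos finite_spin_configs) (auto simp: ising_weight_def)
  then show ?thesis
    by (simp add: ising_prob_def flip: sum_divide_distrib)
qed

text \<open>A vector indexed by the nodes other than \<open>j\<close> is a function on \<open>nat\<close> whose values outside
  \<open>{1..p} - {j}\<close> are never used; a data matrix is a function \<open>x\<close> with \<open>x i k\<close> the \<open>k\<close>-th spin of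
  the \<open>i\<close>-th sample.\<close>

definition logistic_loss :: "real \<Rightarrow> real" where
  "logistic_loss t = ln (1 + exp (- t))"

definition node_loss :: "nat \<Rightarrow> nat \<Rightarrow> (nat \<Rightarrow> nat \<Rightarrow> real) \<Rightarrow> nat \<Rightarrow> (nat \<Rightarrow> real) \<Rightarrow> real" where
  "node_loss p n x j u =
     1 / real n * (\<Sum>i\<in>{1..n}. logistic_loss (2 * (\<Sum>k\<in>{1..p} - {j}. u k * x i j * x i k)))"

definition node_l1_norm :: "nat \<Rightarrow> nat \<Rightarrow> (nat \<Rightarrow> real) \<Rightarrow> real" where
  "node_l1_norm p j u = (\<Sum>k\<in>{1..p} - {j}. \<bar>u k\<bar>)"

definition scad :: "real \<Rightarrow> real \<Rightarrow> real \<Rightarrow> real" where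
  "scad a lam t =
     (if \<bar>t\<bar> \<le> lam then lam * \<bar>t\<bar>
      else if \<bar>t\<bar> \<le> a * lam then (- t\<^sup>2 + 2 * a * lam * \<bar>t\<bar> - lam\<^sup>2) / (2 * (a - 1))
      else (a + 1) * lam\<^sup>2 / 2)"

text \<open>The data sets are indexed by \<open>r \<in> insert 0 A\<close>, with \<open>x r\<close> the data matrix and \<open>n r\<close> the
  sample size of data set \<open>r\<close>.\<close>

definition step1_objective ::
  "nat \<Rightarrow> nat set \<Rightarrow> (nat \<Rightarrow> nat) \<Rightarrow> (nat \<Rightarrow> nat \<Rightarrow> nat \<Rightarrow> real) \<Rightarrow> real \<Rightarrow> nat \<Rightarrow> (nat \<Rightarrow> real) \<Rightarrow> real" where
  "step1_objective p A n x lam_w j u =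
     (\<Sum>r\<in>insert 0 A. real (n r) / real (\<Sum>s\<in>insert 0 A. n s) * node_loss p (n r) (x r) j u)
     + lam_w * node_l1_norm p j u"

definition step2_objective ::
  "nat \<Rightarrow> nat \<Rightarrow> (nat \<Rightarrow> nat \<Rightarrow> real) \<Rightarrow> real \<Rightarrow> real \<Rightarrow> real \<Rightarrow> nat \<Rightarrow> (nat \<Rightarrow> real) \<Rightarrow> (nat \<Rightarrow> real) \<Rightarrow> real" where
  "step2_objective p n0 x0 lam_d lam a j w d =
     node_loss p n0 x0 j (\<lambda>k. w k + d k) + lam_d * node_l1_norm p j d
     + (\<Sum>k\<in>{1..p} - {j}. scad a lam (w k + d k))"

definition is_local_min :: "nat set \<Rightarrow> ((nat \<Rightarrow> real) \<Rightarrow> real) \<Rightarrow> (nat \<Rightarrow> real) \<Rightarrow> bool" where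
  "is_local_min K g d \<longleftrightarrow> (\<exists>\<epsilon>>0. \<forall>d'. (\<forall>k\<in>K. \<bar>d' k - d k\<bar> < \<epsilon>) \<longrightarrow> g d \<le> g d')"

text \<open>\<open>X r i \<omega> k\<close> is the \<open>k\<close>-th spin of the \<open>i\<close>-th sample of data set \<open>r\<close>; \<open>r = 0\<close> is the target.\<close>

locale ising_transfer_data = prob_space M
  for M :: "'a measure" +
  fixes p :: nat
    and \<theta> :: "nat \<Rightarrow> nat \<Rightarrow> real"
    and A :: "nat set"
    and n :: "nat \<Rightarrow> nat"
    and X :: "nat \<Rightarrow> nat \<Rightarrow> 'a \<Rightarrow> nat \<Rightarrow> real"
  assumes theta_sym: "\<And>j k. j \<in> {1..p} \<Longrightarrow> k \<in> {1..p} \<Longrightarrow> \<theta> j k = \<theta> k j"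
    and theta_diag: "\<And>j. j \<in> {1..p} \<Longrightarrow> \<theta> j j = 0"
    and finite_sources: "finite A"
    and zero_notin_sources: "0 \<notin> A"
    and sample_size_pos: "\<And>r. r \<in> insert 0 A \<Longrightarrow> 0 < n r"
    and data_measurable:
      "\<And>r i. r \<in> insert 0 A \<Longrightarrow> i \<in> {1..n r} \<Longrightarrow> X r i \<in> measurable M (count_space (spin_configs p))"
    and target_indep: "indep_vars (\<lambda>_. count_space (spin_configs p)) (X 0) {1..n 0}"
    and target_ising:
      "\<And>i. i \<in> {1..n 0} \<Longrightarrow>
         distributed M (count_space (spin_configs p)) (X 0 i) (\<lambda>x. ennreal (ising_prob p \<theta> x))"

text \<open>\<open>W j k\<close> and \<open>D j k\<close> are the random entries of the first- and second-step estimates of node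
  \<open>j\<close>. The optimization routine of the second step is unconstrained (it may be randomized) except
  that it returns a local minimizer.\<close>

locale oracle_two_step = ising_transfer_data M p \<theta> A n X
  for M :: "'a measure" and p :: nat and \<theta> :: "nat \<Rightarrow> nat \<Rightarrow> real" and A :: "nat set"
    and n :: "nat \<Rightarrow> nat" and X :: "nat \<Rightarrow> nat \<Rightarrow> 'a \<Rightarrow> nat \<Rightarrow> real" +
  fixes lam_w lam_d lam a :: real
    and W D :: "nat \<Rightarrow> nat \<Rightarrow> 'a \<Rightarrow> real"
  assumes lam_nonneg: "0 \<le> lam_w" "0 \<le> lam_d" "0 \<le> lam"
    and scad_parameter: "2 < a"
    and W_measurable: "\<And>j k. j \<in> {1..p} \<Longrightarrow> k \<in> {1..p} - {j} \<Longrightarrow> W j k \<in> borel_measurable M"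
    and D_measurable: "\<And>j k. j \<in> {1..p} \<Longrightarrow> k \<in> {1..p} - {j} \<Longrightarrow> D j k \<in> borel_measurable M"
    and step1: "\<And>j \<omega>. j \<in> {1..p} \<Longrightarrow> \<omega> \<in> space M \<Longrightarrow>
      is_arg_min (step1_objective p A n (\<lambda>r i. X r i \<omega>) lam_w j) (\<lambda>_. True) (\<lambda>k. W j k \<omega>)"
    and step2: "\<And>j \<omega>. j \<in> {1..p} \<Longrightarrow> \<omega> \<in> space M \<Longrightarrow>
      is_local_min ({1..p} - {j})
        (step2_objective p (n 0) (\<lambda>i. X 0 i \<omega>) lam_d lam a j (\<lambda>k. W j k \<omega>)) (\<lambda>k. D j k \<omega>)"

definition asym_estimate ::
  "(nat \<Rightarrow> nat \<Rightarrow> 'a \<Rightarrow> real) \<Rightarrow> (nat \<Rightarrow> nat \<Rightarrow> 'a \<Rightarrow> real) \<Rightarrow> 'a \<Rightarrow> nat \<Rightarrow> nat \<Rightarrow> real" where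
  "asym_estimate W D \<omega> j k = W j k \<omega> + D j k \<omega>"

definition neighborhood :: "nat \<Rightarrow> (nat \<Rightarrow> nat \<Rightarrow> real) \<Rightarrow> nat \<Rightarrow> nat set" where
  "neighborhood p \<theta> j = {k \<in> {1..p}. k \<noteq> j \<and> \<theta> j k \<noteq> 0}"

definition edge_set :: "nat \<Rightarrow> (nat \<Rightarrow> nat \<Rightarrow> real) \<Rightarrow> nat set set" where
  "edge_set p \<theta> = {{j, k} | j k. 1 \<le> j \<and> j < k \<and> k \<le> p \<and> \<theta> j k \<noteq> 0}"

definition and_rule_edges :: "nat \<Rightarrow> (nat \<Rightarrow> nat \<Rightarrow> real) \<Rightarrow> nat set set" where
  "and_rule_edges p t =
     {{j, k} | j k. j \<in> {1..p} \<and> k \<in> {1..p} \<and> j \<noteq> k \<and> t j k \<noteq> 0 \<and> t k j \<noteq> 0}"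

end

theory Submission imports Defs begin

text \<open>Fix an outcome at which every estimated neighborhood is the true one. Then an
  off-diagonal entry of the asymmetric estimate is nonzero exactly when the same entry of \<theta>
  is. As \<theta> is symmetric, the two estimates for a pair are both nonzero on an edge and both
  zero off the edges, so the AND rule returns the target edge set
  (\<open>and_rule_edges_eq_edge_setI\<close>). Hence the recovery event lies inside the event of
  correct edges, whose probability is squeezed between that of the recovery event and 1.
  Monotonicity of the measure requires the larger set to be an event, which is
  \<open>edge_recovery_measurable\<close>.\<close>

text \<open>The AND condition is symmetric in the two nodes, so nothing is lost by listing each pair
  in increasing order. Coding the condition as a 0/1 matrix makes facts about
  \<open>edge_set\<close> available for the AND rule.\<close>

lemma and_rule_edges_conv_edge_set:
  "and_rule_edges p t = edge_set p (\<lambda>j k. of_bool (t j k \<noteq> 0 \<and> t k j \<noteq> 0))"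
proof (intro equalityI subsetI)
  fix e assume "e \<in> and_rule_edges p t"
  then obtain j k where e: "e = {j, k}" "j \<in> {1..p}" "k \<in> {1..p}" "j \<noteq> k" "t j k \<noteq> 0" "t k j \<noteq> 0"
    unfolding and_rule_edges_def by blast
  show "e \<in> edge_set p (\<lambda>j k. of_bool (t j k \<noteq> 0 \<and> t k j \<noteq> 0))"
  proof (cases "j < k")
    case True
    with e show ?thesis
      unfolding edge_set_def by (intro CollectI exI[of _ j] exI[of _ k]) auto
  next
    \<comment> \<open>Now \<open>k < j\<close>, so the witnesses are exchanged.\<close>
    case False
    with e show ?thesis
      unfolding edge_set_def by (intro CollectI exI[of _ k] exI[of _ j]) auto
  qed
next
  fix e assume "e \<in> edge_set p (\<lambda>j k. of_bool (t j k \<noteq> 0 \<and> t k j \<noteq> 0))"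
  then show "e \<in> and_rule_edges p t"
    unfolding edge_set_def and_rule_edges_def by fastforce
qed

text \<open>An unordered pair has only one increasing enumeration, so \<open>j < k\<close>
  determines which matrix entry decides membership.\<close>

lemma doubleton_in_edge_set_iff:
  assumes "j < k"
  shows "{j, k} \<in> edge_set p \<theta> \<longleftrightarrow> 1 \<le> j \<and> k \<le> p \<and> \<theta> j k \<noteq> 0"
  using assms unfolding edge_set_def by (auto simp: doubleton_eq_iff)

text \<open>An edge set encodes precisely the support of the strict upper triangle. This replaces an
  equality of sets of sets by finitely many conditions on entries, the form in which measurability
  can be checked.\<close>

lemma edge_set_eq_iff:
  "edge_set p \<theta> = edge_set p \<theta>' \<longleftrightarrow>
     (\<forall>j\<in>{1..p}. \<forall>k\<in>{j<..p}. \<theta> j k \<noteq> 0 \<longleftrightarrow> \<theta>' j k \<noteq> 0)"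
proof
  assume eq: "edge_set p \<theta> = edge_set p \<theta>'"
  show "\<forall>j\<in>{1..p}. \<forall>k\<in>{j<..p}. \<theta> j k \<noteq> 0 \<longleftrightarrow> \<theta>' j k \<noteq> 0"
  proof (intro ballI)
    fix j k assume "j \<in> {1..p}" "k \<in> {j<..p}"
    then show "\<theta> j k \<noteq> 0 \<longleftrightarrow> \<theta>' j k \<noteq> 0"
      using doubleton_in_edge_set_iff[of j k p \<theta>] doubleton_in_edge_set_iff[of j k p \<theta>'] eq
      by auto
  qed
next
  assume "\<forall>j\<in>{1..p}. \<forall>k\<in>{j<..p}. \<theta> j k \<noteq> 0 \<longleftrightarrow> \<theta>' j k \<noteq> 0"
  then have "1 \<le> j \<and> j < k \<and> k \<le> p \<and> \<theta> j k \<noteq> 0 \<longleftrightarrow> 1 \<le> j \<and> j < k \<and> k \<le> p \<and> \<theta>' j k \<noteq> 0" for j k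
    by auto
  then show "edge_set p \<theta> = edge_set p \<theta>'"
    unfolding edge_set_def by simp
qed

lemma and_rule_edges_eq_edge_set_iff:
  "and_rule_edges p t = edge_set p \<theta> \<longleftrightarrow>
     (\<forall>j\<in>{1..p}. \<forall>k\<in>{j<..p}. t j k \<noteq> 0 \<and> t k j \<noteq> 0 \<longleftrightarrow> \<theta> j k \<noteq> 0)"
  by (simp add: and_rule_edges_conv_edge_set edge_set_eq_iff)

text \<open>The neighborhood of \<open>j\<close> records the support of row \<open>j\<close> only.
  The AND rule also consults the entry in row \<open>k\<close>, and symmetry of \<theta> makes both
  rows give the same verdict.\<close>

lemma and_rule_edges_eq_edge_setI:
  assumes sym: "\<And>j k. j \<in> {1..p} \<Longrightarrow> k \<in> {1..p} \<Longrightarrow> \<theta> j k = \<theta> k j"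
    and nbhd: "\<And>j. j \<in> {1..p} \<Longrightarrow> neighborhood p t j = neighborhood p \<theta> j"
  shows "and_rule_edges p t = edge_set p \<theta>"
proof -
  have "t j k \<noteq> 0 \<longleftrightarrow> \<theta> j k \<noteq> 0" if "j \<in> {1..p}" "k \<in> {1..p}" "j \<noteq> k" for j k
    using nbhd[OF that(1)] that by (auto simp: neighborhood_def set_eq_iff)
  then show ?thesis
    using sym by (auto simp: and_rule_edges_eq_edge_set_iff)
qed

context oracle_two_step
begin

lemma asym_estimate_measurable:
  assumes "j \<in> {1..p}" "k \<in> {1..p} - {j}"
  shows "(\<lambda>\<omega>. asym_estimate W D \<omega> j k) \<in> borel_measurable M"
  using assms W_measurable D_measurable unfolding asym_estimate_def by simp

text \<open>By the entrywise criterion the set is a finite Boolean combination of events that a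
  single estimated entry vanishes, and each such entry is a random variable.\<close>

lemma edge_recovery_measurable:
  "{\<omega> \<in> space M. and_rule_edges p (asym_estimate W D \<omega>) = edge_set p \<theta>} \<in> events"
  unfolding and_rule_edges_eq_edge_set_iff
proof (intro sets.sets_Collect_finite_All finite_atLeastAtMost finite_greaterThanAtMost)
  fix j k assume "j \<in> {1..p}" "k \<in> {j<..p}"
  then have [measurable]:
    "(\<lambda>\<omega>. asym_estimate W D \<omega> j k) \<in> borel_measurable M"
    "(\<lambda>\<omega>. asym_estimate W D \<omega> k j) \<in> borel_measurable M"
    by (auto intro!: asym_estimate_measurable)
  show "{\<omega> \<in> space M. asym_estimate W D \<omega> j k \<noteq> 0 \<and> asym_estimate W D \<omega> k j \<noteq> 0 \<longleftrightarrow> \<theta> j k \<noteq> 0}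
    \<in> events"
    by measurable
qed

text \<open>The inclusion of events holds outcome by outcome, for each fixed problem in the
  sequence; no limit enters yet.\<close>

lemma neighborhood_recovery_prob_le_edge_recovery_prob:
  "prob {\<omega> \<in> space M. \<forall>j\<in>{1..p}.
      neighborhood p (asym_estimate W D \<omega>) j = neighborhood p \<theta> j \<and>
      (\<forall>k\<in>neighborhood p \<theta> j. sgn (asym_estimate W D \<omega> j k) = sgn (\<theta> j k))}
   \<le> prob {\<omega> \<in> space M. and_rule_edges p (asym_estimate W D \<omega>) = edge_set p \<theta>}"
  by (intro finite_measure_mono edge_recovery_measurable subsetI)
     (auto intro!: and_rule_edges_eq_edge_setI theta_sym)

end

theorem corollary2:
  fixes M :: "nat \<Rightarrow> 'a measure"
    and p :: "nat \<Rightarrow> nat"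
    and \<theta> :: "nat \<Rightarrow> nat \<Rightarrow> nat \<Rightarrow> real"
    and A :: "nat \<Rightarrow> nat set"
    and n :: "nat \<Rightarrow> nat \<Rightarrow> nat"
    and X :: "nat \<Rightarrow> nat \<Rightarrow> nat \<Rightarrow> 'a \<Rightarrow> nat \<Rightarrow> real"
    and lam_w lam_d lam a :: "nat \<Rightarrow> real"
    and W D :: "nat \<Rightarrow> nat \<Rightarrow> nat \<Rightarrow> 'a \<Rightarrow> real"
  assumes problem: "\<And>m. oracle_two_step (M m) (p m) (\<theta> m) (A m) (n m) (X m)
                      (lam_w m) (lam_d m) (lam m) (a m) (W m) (D m)"
    and n0_grows: "filterlim (\<lambda>m. n m 0) at_top sequentially"
    and p_grows: "filterlim p at_top sequentially"
    and recovery: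
      "(\<lambda>m. measure (M m) {\<omega> \<in> space (M m). \<forall>j\<in>{1..p m}.
          neighborhood (p m) (asym_estimate (W m) (D m) \<omega>) j = neighborhood (p m) (\<theta> m) j \<and>
          (\<forall>k\<in>neighborhood (p m) (\<theta> m) j.
             sgn (asym_estimate (W m) (D m) \<omega> j k) = sgn (\<theta> m j k))}) \<longlonglongrightarrow> 1"
  shows "(\<lambda>m. measure (M m) {\<omega> \<in> space (M m).
            and_rule_edges (p m) (asym_estimate (W m) (D m) \<omega>) = edge_set (p m) (\<theta> m)}) \<longlonglongrightarrow> 1"
proof (rule tendsto_sandwich[OF _ _ recovery tendsto_const])
  \<comment> \<open>Both bounds of the squeeze hold for every \<open>m\<close>, not just
    eventually.\<close>
  show "\<forall>\<^sub>F m in sequentially.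
    measure (M m) {\<omega> \<in> space (M m). \<forall>j\<in>{1..p m}.
        neighborhood (p m) (asym_estimate (W m) (D m) \<omega>) j = neighborhood (p m) (\<theta> m) j \<and>
        (\<forall>k\<in>neighborhood (p m) (\<theta> m) j.
           sgn (asym_estimate (W m) (D m) \<omega> j k) = sgn (\<theta> m j k))}
    \<le> measure (M m) {\<omega> \<in> space (M m).
        and_rule_edges (p m) (asym_estimate (W m) (D m) \<omega>) = edge_set (p m) (\<theta> m)}"
    by (intro always_eventually allI
        oracle_two_step.neighborhood_recovery_prob_le_edge_recovery_prob[OF problem])
  \<comment> \<open>The upper bound 1 comes from each \<open>M m\<close> being a probability space,
    a fact contained in the locale predicate.\<close>
  have "prob_space (M m)" for m
    using problem[of m] by (simp add: oracle_two_step_def ising_transfer_data_def)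
  then show "\<forall>\<^sub>F m in sequentially.
    measure (M m) {\<omega> \<in> space (M m).
      and_rule_edges (p m) (asym_estimate (W m) (D m) \<omega>) = edge_set (p m) (\<theta> m)} \<le> 1"
    by (intro always_eventually allI prob_space.prob_le_1)
qed

end
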